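(* On an arbitrary topological space $(X,\tau)$, the operator $\Diamond_{\mathrm{st}}$ computes exactly the Kripke diamond over the specialisation preorder $\le_\tau$ defined by $x\le_\tau y$ iff $x\in\mathrm{cl}(\{y\})$; that is, for every topological model on $(X,\tau)$, every formula $\varphi$ and every $x\in X$: $$x\models\Diamond_{\mathrm{st}}\varphi\iff\exists\,y\in X:\ x\le_\tau y\ \text{and}\ y\models\varphi.$$
   Context: Nonstandard setting. For a topological space $(X,\tau)$ let $S=X\cup\mathbb{R}$ and let $V(S)=\bigcup_{k\in\mathbb{N}_0}V_k(S)$ be the superstructure over $S$, where $V_0(S)=S$ and $V_{k+1}(S)=V_k(S)\cup\mathcal{P}(V_k(S))$. A polysaturated nonstandard model is a superstructure $V({}^*S)$ with a star map $A\mapsto{}^*A$ from $V(S)$ to $V({}^*S)$ such that: (1) Extension: ${}^*s=s$ for all $s\in S$; (2) Transfer: a bounded quantifier formula $\Phi(A_1,\dots,A_n)$ is true in $V(S)$ iff $\Phi({}^*A_1,\dots,{}^*A_n)$ is true in $V({}^*S)$; (3) Saturation: every family of internal sets of cardinality at most $\kappa$ with the finite intersection property has non-empty intersection, where $\kappa\ge|V(S)|$ is a fixed cardinal. A set is internal if it is an element of ${}^*C$ for some $C\in V(S)$. One such model is fixed throughout. In particular $X\subseteq{}^*X$. Halo. For $x\in X$, $\mathcal{N}(x)=\{U\in\tau: x\in U\}$ and $\mu(x)=\bigcap_{U\in\mathcal{N}(x)}{}^*U$. Modal semantics. Formulas are built from propositional variables, $\bot$, $\neg$, $\wedge$ and a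 unary $\Diamond_{\mathrm{st}}$. A topological model is $\mathcal{M}=((X,\tau),\nu)$ with $(X,\tau)$ a topological space and $\nu$ a map from propositional variables to $\mathcal{P}(X)$. The extension $\llbracket\varphi\rrbracket\subseteq X$ is defined with $\llbracket p\rrbracket=\nu(p)$, Boolean clauses as usual, and $\llbracket\Diamond_{\mathrm{st}}\varphi\rrbracket=\{x\in X:\mu(x)\cap({}^*\llbracket\varphi\rrbracket\setminus({}^*X\setminus X))\neq\emptyset\}$. Write $x\models\varphi$ for $x\in\llbracket\varphi\rrbracket$. $\mathrm{cl}$ denotes topological closure. *)

theory Defs
  imports "HOL-Analysis.Abstract_Topology"
begin

unbundle cardinal_syntax

section \<open>Superstructures\<close>

text \<open>
  A superstructure does not fit into a simple type built from its base set, so it is carried by an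
  arbitrary type \<open>'u\<close> together with a map \<open>mk :: 'u set \<Rightarrow> 'u\<close> that turns a set of objects into an
  object.  Only the values of \<open>mk\<close> on subsets of some level matter.
\<close>

primrec level :: "('u set \<Rightarrow> 'u) \<Rightarrow> 'u set \<Rightarrow> nat \<Rightarrow> 'u set" where
  "level mk S 0 = S"
| "level mk S (Suc k) = level mk S k \<union> mk ` Pow (level mk S k)"

definition V :: "('u set \<Rightarrow> 'u) \<Rightarrow> 'u set \<Rightarrow> 'u set" where
  "V mk S = (\<Union>k. level mk S k)"

definition sets_of :: "('u set \<Rightarrow> 'u) \<Rightarrow> 'u set \<Rightarrow> 'u set set" where
  "sets_of mk S = (\<Union>k. Pow (level mk S k))"

text \<open>
  Distinct sets are distinct objects (extensionality), and the elements of the base set are atoms.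
\<close>

locale superstructure =
  fixes mk :: "'u set \<Rightarrow> 'u" and S :: "'u set"
  assumes mk_inj: "inj_on mk (sets_of mk S)"
    and atoms: "mk ` sets_of mk S \<inter> S = {}"

definition elts :: "('u set \<Rightarrow> 'u) \<Rightarrow> 'u set \<Rightarrow> 'u \<Rightarrow> 'u set" where
  "elts mk S a = {b. \<exists>A \<in> sets_of mk S. a = mk A \<and> b \<in> A}"


section \<open>Bounded quantifier formulas\<close>

text \<open>
  Variables are natural numbers; \<open>BAll i j \<phi>\<close> stands for \<open>\<forall>v\<^sub>i \<in> v\<^sub>j. \<phi>\<close>, where \<open>v\<^sub>j\<close> is evaluated
  outside the scope of the quantifier.  The other connectives and the bounded existential
  quantifier are definable.
\<close>

datatype bqf =
    Eq nat nat
  | Mem nat nat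
  | Not bqf
  | And bqf bqf
  | BAll nat nat bqf

primrec holds :: "('u set \<Rightarrow> 'u) \<Rightarrow> 'u set \<Rightarrow> (nat \<Rightarrow> 'u) \<Rightarrow> bqf \<Rightarrow> bool" where
  "holds mk S e (Eq i j) \<longleftrightarrow> e i = e j"
| "holds mk S e (Mem i j) \<longleftrightarrow> e i \<in> elts mk S (e j)"
| "holds mk S e (Not \<phi>) \<longleftrightarrow> \<not> holds mk S e \<phi>"
| "holds mk S e (And \<phi> \<psi>) \<longleftrightarrow> holds mk S e \<phi> \<and> holds mk S e \<psi>"
| "holds mk S e (BAll i j \<phi>) \<longleftrightarrow>
     (\<forall>a \<in> V mk S. a \<in> elts mk S (e j) \<longrightarrow> holds mk S (e(i := a)) \<phi>)"

hide_const (open) Eq Mem Not And BAll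


section \<open>Polysaturated nonstandard models\<close>

definition internal :: "('u set \<Rightarrow> 'u) \<Rightarrow> 'u set \<Rightarrow> 'u set \<Rightarrow> ('u \<Rightarrow> 'u) \<Rightarrow> 'u set \<Rightarrow> bool" where
  "internal mk S S' star A \<longleftrightarrow>
     A \<in> sets_of mk S' \<and> (\<exists>C \<in> V mk S. mk A \<in> elts mk S' (star C))"

text \<open>
  \<open>S'\<close> is the base set of the second superstructure; \<open>star_base\<close> says that it is the star
  of \<open>S\<close>.  Both superstructures use the same \<open>mk\<close>, so that \<open>S \<subseteq> S'\<close> and \<open>V mk S \<subseteq> V mk S'\<close>
  hold literally.
\<close>

locale polysaturated_model =
  std: superstructure mk S + nonstd: superstructure mk S'
  for mk :: "'u set \<Rightarrow> 'u" and S S' :: "'u set" +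
  fixes star :: "'u \<Rightarrow> 'u" and \<kappa> :: "'k rel"
  assumes star_in: "\<And>a. a \<in> V mk S \<Longrightarrow> star a \<in> V mk S'"
    and star_base: "star (mk S) = mk S'"
    and extension: "\<And>s. s \<in> S \<Longrightarrow> star s = s"
    and transfer: "\<And>\<phi> e. range e \<subseteq> V mk S \<Longrightarrow>
      holds mk S e \<phi> \<longleftrightarrow> holds mk S' (\<lambda>i. star (e i)) \<phi>"
    and kappa: "Card_order \<kappa>" "|V mk S| \<le>o \<kappa>"
    and saturation: "\<And>\<A>. \<forall>A \<in> \<A>. internal mk S S' star A \<Longrightarrow> |\<A>| \<le>o \<kappa> \<Longrightarrow>
      \<forall>\<F> \<subseteq> \<A>. finite \<F> \<longrightarrow> \<Inter>\<F> \<noteq> {} \<Longrightarrow> \<Inter>\<A> \<noteq> {}"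

definition star_set :: "('u set \<Rightarrow> 'u) \<Rightarrow> 'u set \<Rightarrow> ('u \<Rightarrow> 'u) \<Rightarrow> 'u set \<Rightarrow> 'u set" where
  "star_set mk S' star A = elts mk S' (star (mk A))"

definition halo ::
  "('u set \<Rightarrow> 'u) \<Rightarrow> 'u set \<Rightarrow> ('u \<Rightarrow> 'u) \<Rightarrow> 'u topology \<Rightarrow> 'u \<Rightarrow> 'u set" where
  "halo mk S' star X x = (\<Inter>U \<in> {U. openin X U \<and> x \<in> U}. star_set mk S' star U)"


section \<open>Modal semantics\<close>

datatype 'p form =
    Var 'p
  | Bot
  | Neg "'p form"
  | Conj "'p form" "'p form"
  | Dia "'p form"

primrec truth_set ::
  "('u set \<Rightarrow> 'u) \<Rightarrow> 'u set \<Rightarrow> ('u \<Rightarrow> 'u) \<Rightarrow> 'u topology \<Rightarrow> ('p \<Rightarrow> 'u set) \<Rightarrow> 'p form \<Rightarrow> 'u set"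
where
  "truth_set mk S' star X \<nu> (Var p) = \<nu> p"
| "truth_set mk S' star X \<nu> Bot = {}"
| "truth_set mk S' star X \<nu> (Neg \<phi>) = topspace X - truth_set mk S' star X \<nu> \<phi>"
| "truth_set mk S' star X \<nu> (Conj \<phi> \<psi>) =
     truth_set mk S' star X \<nu> \<phi> \<inter> truth_set mk S' star X \<nu> \<psi>"
| "truth_set mk S' star X \<nu> (Dia \<phi>) =
     {x \<in> topspace X. halo mk S' star X x \<inter>
        (star_set mk S' star (truth_set mk S' star X \<nu> \<phi>) -
          (star_set mk S' star (topspace X) - topspace X)) \<noteq> {}}"

definition spec_le :: "'u topology \<Rightarrow> 'u \<Rightarrow> 'u \<Rightarrow> bool" where
  "spec_le X x y \<longleftrightarrow> x \<in> X closure_of {y}"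

end

theory Submission
  imports Defs
begin

text \<open>
  Subtracting the nonstandard points \<open>\<^sup>*X \<setminus> X\<close> leaves only standard witnesses for \<open>Dia\<close>, and on
  standard points the star map is invisible: by transfer of the atomic formula \<open>y \<in> A\<close>, together
  with \<open>\<^sup>*y = y\<close>, a point \<open>y\<close> of the base set lies in \<open>\<^sup>*A\<close> iff it lies in \<open>A\<close>
  (\<open>base_point_in_star_set_iff\<close>).  The standard points of the halo of \<open>x\<close> are therefore the points
  common to all open neighbourhoods of \<open>x\<close>, which are exactly the \<open>y\<close> with \<open>x \<in> cl {y}\<close>
  (\<open>halo_Int_topspace\<close>).  A witness for \<open>Dia \<phi>\<close> at \<open>x\<close> is hence a point of the truth set of \<open>\<phi>\<close>
  that lies above \<open>x\<close> in the specialisation preorder.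
\<close>

lemma (in superstructure) elts_mk:
  assumes "A \<in> sets_of mk S"
  shows "elts mk S (mk A) = A"
  using assms mk_inj by (auto simp: elts_def dest: inj_onD)

lemma base_subset_V: "S \<subseteq> V mk S"
  unfolding V_def by (rule UN_upper[of 0 UNIV "level mk S", simplified])

lemma mk_subset_base_in_V:
  assumes "A \<subseteq> S"
  shows "mk A \<in> V mk S"
proof -
  have "mk A \<in> level mk S (Suc 0)"
    using assms by auto
  then show ?thesis
    unfolding V_def by blast
qed

lemma subset_base_in_sets_of:
  assumes "A \<subseteq> S"
  shows "A \<in> sets_of mk S"
  unfolding sets_of_def by (rule UN_I[of 0]) (simp_all add: assms)

context polysaturated_model
begin

text \<open>
  This is the whole nonstandard content of the characterisation: transfer for a single atomic
  formula, where the point is its own star because it belongs to the base set.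
\<close>

lemma base_point_in_star_set_iff:
  assumes "y \<in> S" and "A \<subseteq> S"
  shows "y \<in> star_set mk S' star A \<longleftrightarrow> y \<in> A"
proof -
  define e where "e i = (if i = 0 then y else mk A)" for i :: nat
  have "range e \<subseteq> V mk S"
    using assms base_subset_V[of S mk] mk_subset_base_in_V[of A S mk] by (auto simp: e_def)
  from transfer[OF this, of "bqf.Mem 0 1"]
  have "y \<in> elts mk S (mk A) \<longleftrightarrow> star y \<in> elts mk S' (star (mk A))"
    by (simp add: e_def)
  then show ?thesis
    using assms by (simp add: std.elts_mk subset_base_in_sets_of extension star_set_def)
qed

lemma star_set_Int_base:
  assumes "A \<subseteq> S"
  shows "star_set mk S' star A \<inter> S = A"
  using assms base_point_in_star_set_iff by blast

lemma halo_Int_topspace: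
  assumes "topspace X \<subseteq> S" and "x \<in> topspace X"
  shows "halo mk S' star X x \<inter> topspace X = {y \<in> topspace X. spec_le X x y}"
proof -
  have star_open: "y \<in> star_set mk S' star U \<longleftrightarrow> y \<in> U"
    if "y \<in> topspace X" "openin X U" for y U
  proof (rule base_point_in_star_set_iff)
    show "y \<in> S"
      using that(1) assms(1) by (rule rev_subsetD)
    show "U \<subseteq> S"
      using openin_subset[OF that(2)] assms(1) by (rule subset_trans)
  qed
  have "y \<in> halo mk S' star X x \<longleftrightarrow> spec_le X x y" if "y \<in> topspace X" for y
  proof -
    have "y \<in> halo mk S' star X x \<longleftrightarrow> (\<forall>U. x \<in> U \<and> openin X U \<longrightarrow> y \<in> U)"
      using star_open[OF that] by (auto simp: halo_def)
    also have "\<dots> \<longleftrightarrow> spec_le X x y"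
      using assms(2) by (simp add: spec_le_def in_closure_of)
    finally show ?thesis .
  qed
  then show ?thesis
    by blast
qed

text \<open>
  The whole space is itself an open neighbourhood of each of its points.  This is why a point of a
  halo that survives the subtraction of \<open>\<^sup>*X \<setminus> X\<close> is standard.
\<close>

lemma halo_subset_star_topspace:
  assumes "x \<in> topspace X"
  shows "halo mk S' star X x \<subseteq> star_set mk S' star (topspace X)"
  using assms by (auto simp: halo_def)

end

lemma truth_set_subset_topspace:
  assumes "\<And>p. \<nu> p \<subseteq> topspace X"
  shows "truth_set mk S' star X \<nu> \<phi> \<subseteq> topspace X"
  using assms by (induction \<phi>) auto

theorem proposition4p1:
  fixes X :: "'u topology" and real_emb :: "real \<Rightarrow> 'u"
    and mk :: "'u set \<Rightarrow> 'u" and S' :: "'u set" and star :: "'u \<Rightarrow> 'u" and \<kappa> :: "'k rel"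
    and \<nu> :: "'p \<Rightarrow> 'u set" and \<phi> :: "'p form" and x :: 'u
  assumes "inj real_emb"
    and "polysaturated_model mk (topspace X \<union> range real_emb) S' star \<kappa>"
    and "\<And>p. \<nu> p \<subseteq> topspace X"
    and "x \<in> topspace X"
  shows "x \<in> truth_set mk S' star X \<nu> (Dia \<phi>) \<longleftrightarrow>
    (\<exists>y \<in> topspace X. spec_le X x y \<and> y \<in> truth_set mk S' star X \<nu> \<phi>)"
proof -
  interpret polysaturated_model mk "topspace X \<union> range real_emb" S' star \<kappa>
    by (fact assms(2))
  let ?T = "truth_set mk S' star X \<nu> \<phi>"
  let ?H = "halo mk S' star X x"
  have "?T \<subseteq> topspace X"
    using assms(3) by (rule truth_set_subset_topspace)
  then have T: "star_set mk S' star ?T \<inter> topspace X = ?T"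
    using star_set_Int_base[of ?T] by blast
  have "x \<in> truth_set mk S' star X \<nu> (Dia \<phi>) \<longleftrightarrow>
      ?H \<inter> (star_set mk S' star ?T - (star_set mk S' star (topspace X) - topspace X)) \<noteq> {}"
    using assms(4) by simp
  also have "\<dots> \<longleftrightarrow> (?H \<inter> topspace X) \<inter> (star_set mk S' star ?T \<inter> topspace X) \<noteq> {}"
    using halo_subset_star_topspace[OF assms(4)] by blast
  also have "\<dots> \<longleftrightarrow> {y \<in> topspace X. spec_le X x y} \<inter> ?T \<noteq> {}"
    unfolding T using halo_Int_topspace[OF _ assms(4)] by simp
  also have "\<dots> \<longleftrightarrow> (\<exists>y \<in> topspace X. spec_le X x y \<and> y \<in> ?T)"
    by blast
  finally show ?thesis .
qed

end
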